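(* Let $\|\cdot\|_{\mathcal P}$ be a norm on $\mathbb{R}^2$ whose closed unit ball $\mathcal{P}$ is a quadrilateral with facets $\pm F_1,\pm F_2$. Let $G=(V,E)$ be a $\mathbb{Z}_2$-symmetric graph with action $\theta:\mathbb{Z}_2\to\mathrm{Aut}(G)$, and let $(G,p)$ be a well-positioned bar-joint framework in $(\mathbb{R}^2,\|\cdot\|_{\mathcal P})$ which is $\mathbb{Z}_2$-symmetric with respect to $\theta$ and a representation $\tau:\mathbb{Z}_2\to\mathrm{Isom}(\mathbb{R}^2,\|\cdot\|_{\mathcal P})$. Suppose that $\theta$ acts freely on $V$ and that $\tau(-1)$ is a reflection in the mirror $\ker\varphi_{F_1}$ along $\ker\varphi_{F_2}$. The following are equivalent. (i) $(G,p)$ is infinitesimally rigid. (ii) The monochrome subgraphs $G_{F_1,0}$ and $G_{F_2,0}$ of $G_0$ both contain connected spanning unbalanced map graphs.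
   Context: **Graphs.** $G=(V,E)$ is a finite simple undirected graph. $\mathbb{Z}_2=\{1,-1\}$ (multiplicative). A $\mathbb{Z}_2$-symmetric graph is a graph $G$ with a homomorphism $\theta:\mathbb{Z}_2\to\mathrm{Aut}(G)$; write $-v=\theta(-1)v$ and $-e=(-v)(-w)$ for $e=vw\in E$. The action is free on $V$: $v\ne -v$ for all $v$. An edge $e$ with $e=-e$ is called fixed (such edges are allowed). Orbits are $[v]=\{v,-v\}$, $[e]=\{e,-e\}$; $V_0,E_0$ are the sets of vertex and edge orbits. The quotient graph $G_0$ has vertex set $V_0$ and edge set $E_0$, with $[e]$ incident to $[v]$ if $e$ is incident to $v$ or $-v$; it may have loops (from fixed edges) and parallel edges. Given a set $\tilde V_0$ of representatives of the vertex orbits, the gain $\psi:E_0\to\mathbb{Z}_2$ is $\psi_{[e]}=1$ if $e$ or $-e$ joins two vertices of $\tilde V_0$, and $\psi_{[e]}=-1$ otherwise (so loops have gain $-1$). The gain of a cycle is the product of the gains of its edges (loops are cycles of length 1, pairs of parallel edges are cycles of length 2). An edge set or subgraph is balanced if each of its cycles (if any) has gain $1$, and unbalanced otherwise; this does not depend on $\tilde V_0$. An unbalanced map graph in $G_0$ is a subgraph of $G_0$ in which every connected component contains exactly one cycle, each of these cycles being unbalanced. **Frameworks.** For a finite dimensional real normed space $(X,\|\cdot\|)$, a bar-joint framework is a pair $(G,p)$ with $p=(p_v)\in X^{|V|}$ and $p_v\neq p_w$ for $vw\in E$. It is well-positioned if the rigidity map $f_G:X^{|V|}\to\mathbb{R}^{|E|}$,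 $f_G(x)=(\|x_v-x_w\|)_{vw\in E}$, is differentiable at $p$. An infinitesimal flex is $u\in X^{|V|}$ whose directional derivative $D_uf_G(p)=\lim_{t\to0}\frac1t(f_G(p+tu)-f_G(p))$ is $0$. A rigid motion of $X$ is a family of continuous paths $\{\alpha_x:[-1,1]\to X\}_{x\in X}$, each differentiable at $0$, with $\alpha_x(0)=x$ and $\|\alpha_x(t)-\alpha_y(t)\|=\|x-y\|$ for all $x,y,t$; a flex is trivial if it equals $(\alpha_{p_v}'(0))_{v\in V}$ for some rigid motion. $(G,p)$ is infinitesimally rigid if every infinitesimal flex is trivial. $\mathrm{Isom}(X,\|\cdot\|)$ is the group of linear isometries. $(G,p)$ is $\mathbb{Z}_2$-symmetric with respect to $\theta$ and a representation $\tau:\mathbb{Z}_2\to\mathrm{Isom}(X,\|\cdot\|)$ if $\tau(-1)p_v=p_{-v}$ for all $v$. If $X=Z\oplus W$ with $\dim W=1$, a linear isometry $T$ is a reflection in the mirror $Z$ along $W$ if $T=I-2P$, where $P$ is the projection with range $W$ and kernel $Z$. **Quadrilateral norms.** Write $\mathcal{P}=\bigcap_{j=1,2}\{x\in\mathbb{R}^2:|x\cdot\hat F_j|\le1\}$, so $\|x\|_{\mathcal P}=\max_{j}|\hat F_j\cdot x|$, where $F_j=\{x\in\mathcal{P}:\hat F_j\cdot x=1\}$; put $\varphi_{F_j}(x)=\hat F_j\cdot x$. An edge $vw\in E$ has framework colour $[F]$ if $p_v-p_w$ lies in the cone of $F$ or $-F$; in a well-positioned framework each edge has exactly one colour. If $(G,p)$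 is well-positioned and $\mathbb{Z}_2$-symmetric with respect to $\theta$ and $\tau$, where $\tau(-1)$ is a reflection in the mirror $\ker\varphi_{F_1}$ along $\ker\varphi_{F_2}$, then $e$ and $-e$ have the same colour for every $e\in E$, called the colour of $[e]$. $G_{F,0}$ is the monochrome subgraph of $G_0$ spanned by the edges $[e]$ of colour $[F]$. "Spanning in $G_0$" means having vertex set $V_0$. *)

theory Defs
  imports "HOL-Analysis.Analysis" "HOL-Algebra.Sym_Groups"
begin

section \<open>Multigraphs, cycles and gains\<close>

text \<open>
  Loops and parallel edges are allowed: \<open>ends G e\<close> is the set of vertices incident to \<open>e\<close>,
  which is a singleton if \<open>e\<close> is a loop.
\<close>

record ('a, 'e) multigraph =
  verts :: "'a set"
  edges :: "'e set"
  ends :: "'e \<Rightarrow> 'a set"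

definition subgraph_of :: "('a, 'e) multigraph \<Rightarrow> ('a, 'e) multigraph \<Rightarrow> bool" where
  "subgraph_of H G \<longleftrightarrow>
     verts H \<subseteq> verts G \<and> edges H \<subseteq> edges G \<and>
     (\<forall>e\<in>edges H. ends H e = ends G e \<and> ends H e \<subseteq> verts H)"

definition adjacent :: "('a, 'e) multigraph \<Rightarrow> 'a \<Rightarrow> 'a \<Rightarrow> bool" where
  "adjacent G a b \<longleftrightarrow> (\<exists>e\<in>edges G. ends G e = {a, b})"

definition connected_graph :: "('a, 'e) multigraph \<Rightarrow> bool" where
  "connected_graph G \<longleftrightarrow> (\<forall>a\<in>verts G. \<forall>b\<in>verts G. (adjacent G)\<^sup>*\<^sup>* a b)"

definition graph_component :: "('a, 'e) multigraph \<Rightarrow> 'a \<Rightarrow> ('a, 'e) multigraph" where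
  "graph_component G a =
     (let K = {b \<in> verts G. (adjacent G)\<^sup>*\<^sup>* a b}
      in \<lparr>verts = K, edges = {e \<in> edges G. ends G e \<subseteq> K}, ends = ends G\<rparr>)"

definition graph_components :: "('a, 'e) multigraph \<Rightarrow> ('a, 'e) multigraph set" where
  "graph_components G = graph_component G ` verts G"

text \<open>
  A cycle is identified with its edge set, so that rotations and reversals of a closed
  walk give the same cycle.  Length one gives the loops and length two the pairs of
  parallel edges.
\<close>

definition is_cycle :: "('a, 'e) multigraph \<Rightarrow> 'e set \<Rightarrow> bool" where
  "is_cycle G C \<longleftrightarrow>
     (\<exists>vs es. es \<noteq> [] \<and> length vs = length es \<and> distinct vs \<and> distinct es \<and>
        set vs \<subseteq> verts G \<and> set es \<subseteq> edges G \<and>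
        (\<forall>i<length es. ends G (es ! i) = {vs ! i, vs ! (Suc i mod length es)}) \<and>
        C = set es)"

definition balanced :: "('a, 'e) multigraph \<Rightarrow> ('e \<Rightarrow> int) \<Rightarrow> 'e set \<Rightarrow> bool" where
  "balanced G \<psi> S \<longleftrightarrow> (\<forall>C. C \<subseteq> S \<and> is_cycle G C \<longrightarrow> prod \<psi> C = 1)"

definition unbalanced_map_graph ::
    "('a, 'e) multigraph \<Rightarrow> ('e \<Rightarrow> int) \<Rightarrow> ('a, 'e) multigraph \<Rightarrow> bool" where
  "unbalanced_map_graph G \<psi> H \<longleftrightarrow>
     subgraph_of H G \<and>
     (\<forall>K\<in>graph_components H. (\<exists>!C. is_cycle K C) \<and> (\<forall>C. is_cycle K C \<longrightarrow> \<not> balanced G \<psi> C))"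

definition spanning_in :: "('a, 'e) multigraph \<Rightarrow> ('a, 'e) multigraph \<Rightarrow> bool" where
  "spanning_in G H \<longleftrightarrow> verts H = verts G"


section \<open>Symmetric graphs and their quotients\<close>

text \<open>
  The vertex set of a graph is the whole of a finite type, and a graph is given by its set of
  edges.  The group \<open>sign_img\<close> is the multiplicative group with carrier \<open>{-1, 1}\<close>.
\<close>

definition simple_graph :: "'v::finite set set \<Rightarrow> bool" where
  "simple_graph E \<longleftrightarrow> (\<forall>e\<in>E. card e = 2)"

definition graph_aut :: "'v::finite set set \<Rightarrow> ('v \<Rightarrow> 'v) monoid" where
  "graph_aut E = \<lparr>carrier = {f. bij f \<and> (\<forall>v w. {f v, f w} \<in> E \<longleftrightarrow> {v, w} \<in> E)},
                  mult = (\<circ>), one = id\<rparr>"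

definition symmetric_graph :: "'v::finite set set \<Rightarrow> (int \<Rightarrow> 'v \<Rightarrow> 'v) \<Rightarrow> bool" where
  "symmetric_graph E \<theta> \<longleftrightarrow> simple_graph E \<and> \<theta> \<in> hom sign_img (graph_aut E)"

definition free_action :: "(int \<Rightarrow> 'v \<Rightarrow> 'v) \<Rightarrow> bool" where
  "free_action \<theta> \<longleftrightarrow> (\<forall>v. v \<noteq> \<theta> (-1) v)"

definition vertex_orbit :: "(int \<Rightarrow> 'v \<Rightarrow> 'v) \<Rightarrow> 'v \<Rightarrow> 'v set" where
  "vertex_orbit \<theta> v = {v, \<theta> (-1) v}"

definition edge_orbit :: "(int \<Rightarrow> 'v \<Rightarrow> 'v) \<Rightarrow> 'v set \<Rightarrow> 'v set set" where
  "edge_orbit \<theta> e = {e, \<theta> (-1) ` e}"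

definition quotient_graph ::
    "'v::finite set set \<Rightarrow> (int \<Rightarrow> 'v \<Rightarrow> 'v) \<Rightarrow> ('v set, 'v set set) multigraph" where
  "quotient_graph E \<theta> =
     \<lparr>verts = range (vertex_orbit \<theta>),
      edges = edge_orbit \<theta> ` E,
      ends = (\<lambda>b. {vertex_orbit \<theta> v | v e. e \<in> b \<and> (v \<in> e \<or> \<theta> (-1) v \<in> e)})\<rparr>"

definition vertex_representatives :: "(int \<Rightarrow> 'v \<Rightarrow> 'v) \<Rightarrow> 'v set \<Rightarrow> bool" where
  "vertex_representatives \<theta> R \<longleftrightarrow> (\<forall>a\<in>range (vertex_orbit \<theta>). \<exists>!v. v \<in> R \<inter> a)"

definition gain :: "'v set \<Rightarrow> 'v set set \<Rightarrow> int" where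
  "gain R b = (if \<exists>e\<in>b. e \<subseteq> R then 1 else -1)"


section \<open>Bar-joint frameworks in normed spaces\<close>

text \<open>
  The norm is an arbitrary function \<open>N\<close> on a finite dimensional space.  Continuity and
  differentiability refer to the standard topology of that space, which is also the topology
  of \<open>N\<close>.
\<close>

definition is_norm :: "('a::euclidean_space \<Rightarrow> real) \<Rightarrow> bool" where
  "is_norm N \<longleftrightarrow>
     (\<forall>x. 0 \<le> N x) \<and> (\<forall>x. N x = 0 \<longleftrightarrow> x = 0) \<and>
     (\<forall>c x. N (c *\<^sub>R x) = \<bar>c\<bar> * N x) \<and> (\<forall>x y. N (x + y) \<le> N x + N y)"

definition framework :: "'v::finite set set \<Rightarrow> 'a::euclidean_space ^ 'v \<Rightarrow> bool" where
  "framework E p \<longleftrightarrow> (\<forall>v w. {v, w} \<in> E \<longrightarrow> p $ v \<noteq> p $ w)"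

definition edge_length ::
    "('a::euclidean_space \<Rightarrow> real) \<Rightarrow> 'a ^ 'v::finite \<Rightarrow> 'v set \<Rightarrow> real" where
  "edge_length N x e = (THE r. \<exists>v w. e = {v, w} \<and> r = N (x $ v - x $ w))"

lemma edge_length_eq:
  assumes "is_norm N" "v \<noteq> w"
  shows "edge_length N x {v, w} = N (x $ v - x $ w)"
proof -
  have "N (x $ w - x $ v) = N (x $ v - x $ w)"
  proof -
    have "N ((-1) *\<^sub>R (x $ v - x $ w)) = \<bar>-1\<bar> * N (x $ v - x $ w)"
      using assms(1) unfolding is_norm_def by blast
    then show ?thesis by simp
  qed
  then show ?thesis
    unfolding edge_length_def using assms(2)
    by (intro the_equality) (auto simp: doubleton_eq_iff)
qed

text \<open>
  The codomain has one coordinate for each set of vertices; those that are not edges carry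
  the constant 0, so that this is the rigidity map into the coordinate subspace indexed by \<open>E\<close>.
\<close>

definition rigidity_map ::
    "('a::euclidean_space \<Rightarrow> real) \<Rightarrow> 'v::finite set set \<Rightarrow> 'a ^ 'v \<Rightarrow> real ^ ('v set)" where
  "rigidity_map N E x = (\<chi> e. if e \<in> E then edge_length N x e else 0)"

definition well_positioned ::
    "('a::euclidean_space \<Rightarrow> real) \<Rightarrow> 'v::finite set set \<Rightarrow> 'a ^ 'v \<Rightarrow> bool" where
  "well_positioned N E p \<longleftrightarrow> rigidity_map N E differentiable (at p)"

definition infinitesimal_flex ::
    "('a::euclidean_space \<Rightarrow> real) \<Rightarrow> 'v::finite set set \<Rightarrow> 'a ^ 'v \<Rightarrow> 'a ^ 'v \<Rightarrow> bool" where
  "infinitesimal_flex N E p u \<longleftrightarrow>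
     ((\<lambda>t. (1 / t) *\<^sub>R (rigidity_map N E (p + t *\<^sub>R u) - rigidity_map N E p)) \<longlongrightarrow> 0) (at (0::real))"

definition rigid_motion ::
    "('a::euclidean_space \<Rightarrow> real) \<Rightarrow> ('a \<Rightarrow> real \<Rightarrow> 'a) \<Rightarrow> bool" where
  "rigid_motion N \<alpha> \<longleftrightarrow>
     (\<forall>x. continuous_on {-1..1} (\<alpha> x) \<and> \<alpha> x differentiable (at 0) \<and> \<alpha> x 0 = x) \<and>
     (\<forall>x y. \<forall>t\<in>{-1..1}. N (\<alpha> x t - \<alpha> y t) = N (x - y))"

definition trivial_flex ::
    "('a::euclidean_space \<Rightarrow> real) \<Rightarrow> 'a ^ 'v::finite \<Rightarrow> 'a ^ 'v \<Rightarrow> bool" where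
  "trivial_flex N p u \<longleftrightarrow>
     (\<exists>\<alpha>. rigid_motion N \<alpha> \<and> (\<forall>v. (\<alpha> (p $ v) has_vector_derivative u $ v) (at 0)))"

definition infinitesimally_rigid ::
    "('a::euclidean_space \<Rightarrow> real) \<Rightarrow> 'v::finite set set \<Rightarrow> 'a ^ 'v \<Rightarrow> bool" where
  "infinitesimally_rigid N E p \<longleftrightarrow> (\<forall>u. infinitesimal_flex N E p u \<longrightarrow> trivial_flex N p u)"

definition isom_group :: "('a::euclidean_space \<Rightarrow> real) \<Rightarrow> ('a \<Rightarrow> 'a) monoid" where
  "isom_group N = \<lparr>carrier = {T. linear T \<and> bij T \<and> (\<forall>x. N (T x) = N x)},
                   mult = (\<circ>), one = id\<rparr>"

definition symmetric_framework ::
    "(int \<Rightarrow> 'v::finite \<Rightarrow> 'v) \<Rightarrow> (int \<Rightarrow> 'a \<Rightarrow> 'a) \<Rightarrow> 'a::euclidean_space ^ 'v \<Rightarrow> bool" where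
  "symmetric_framework \<theta> \<tau> p \<longleftrightarrow> (\<forall>v. \<tau> (-1) (p $ v) = p $ \<theta> (-1) v)"

definition is_reflection ::
    "('a::euclidean_space \<Rightarrow> 'a) \<Rightarrow> 'a set \<Rightarrow> 'a set \<Rightarrow> bool" where
  "is_reflection T Z W \<longleftrightarrow>
     subspace Z \<and> subspace W \<and> Z \<inter> W = {0} \<and> {z + w | z w. z \<in> Z \<and> w \<in> W} = UNIV \<and> dim W = 1 \<and>
     (\<exists>P. linear P \<and> P \<circ> P = P \<and> range P = W \<and> {x. P x = 0} = Z \<and> T = (\<lambda>x. x - 2 *\<^sub>R P x))"


section \<open>Quadrilateral norms and framework colours\<close>

text \<open>
  The facets of the unit ball are exactly \<open>F\<^sub>1, -F\<^sub>1, F\<^sub>2, -F\<^sub>2\<close>, and \<open>a\<^sub>1, a\<^sub>2\<close> are the normal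
  vectors with respect to which \<open>F\<^sub>j\<close> is the part of the unit ball where \<open>a\<^sub>j \<bullet> x = 1\<close>;
  the linear functional associated with \<open>F\<^sub>j\<close> is \<open>\<lambda>x. a\<^sub>j \<bullet> x\<close>.
\<close>

definition quadrilateral_norm ::
    "(real ^ 2 \<Rightarrow> real) \<Rightarrow> (real ^ 2) set \<Rightarrow> (real ^ 2) set \<Rightarrow> real ^ 2 \<Rightarrow> real ^ 2 \<Rightarrow> bool" where
  "quadrilateral_norm N F\<^sub>1 F\<^sub>2 a\<^sub>1 a\<^sub>2 \<longleftrightarrow>
     is_norm N \<and>
     (let B = {x. N x \<le> 1} in
        polytope B \<and>
        card {F. F facet_of B} = 4 \<and>
        {F. F facet_of B} = {F\<^sub>1, uminus ` F\<^sub>1, F\<^sub>2, uminus ` F\<^sub>2} \<and>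
        B = {x. \<bar>a\<^sub>1 \<bullet> x\<bar> \<le> 1} \<inter> {x. \<bar>a\<^sub>2 \<bullet> x\<bar> \<le> 1} \<and>
        F\<^sub>1 = {x \<in> B. a\<^sub>1 \<bullet> x = 1} \<and>
        F\<^sub>2 = {x \<in> B. a\<^sub>2 \<bullet> x = 1})"

definition edge_has_colour ::
    "(real ^ 2) ^ 'v::finite \<Rightarrow> (real ^ 2) set \<Rightarrow> 'v set \<Rightarrow> bool" where
  "edge_has_colour p F e \<longleftrightarrow>
     (\<exists>v w. e = {v, w} \<and> p $ v - p $ w \<in> cone hull F \<union> cone hull (uminus ` F))"

definition monochrome_quotient ::
    "'v::finite set set \<Rightarrow> (int \<Rightarrow> 'v \<Rightarrow> 'v) \<Rightarrow> (real ^ 2) ^ 'v \<Rightarrow> (real ^ 2) set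
       \<Rightarrow> ('v set, 'v set set) multigraph" where
  "monochrome_quotient E \<theta> p F =
     (let G\<^sub>0 = quotient_graph E \<theta>; M = {b \<in> edges G\<^sub>0. \<forall>e\<in>b. edge_has_colour p F e}
      in \<lparr>verts = \<Union> (ends G\<^sub>0 ` M), edges = M, ends = ends G\<^sub>0\<rparr>)"

end

theory Submission
  imports Defs
begin

text \<open>
  In the coordinates \<open>a\<^sub>1 \<bullet> x\<close> and \<open>a\<^sub>2 \<bullet> x\<close> the norm is the maximum norm, and well-positionedness
  says that for each edge one of the two coordinates strictly dominates the other; it determines the
  colour of the edge.  Near the framework, the length of an edge of colour \<open>F\<^sub>j\<close> is \<open>\<plusminus>\<close> the \<open>j\<close>-th
  coordinate of the edge vector.  An infinitesimal flex is therefore a pair of real functions on the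
  vertices, the \<open>j\<close>-th of which is constant along the edges of colour \<open>F\<^sub>j\<close>.  The trivial flexes are
  the constant ones, since differentiating the constant distances in a rigid motion shows that all
  points move with the same velocity.  Hence the framework is infinitesimally rigid iff both
  monochrome subgraphs of \<open>G\<close> connect all the vertices (\<open>rigid_iff_governed_connected\<close>).

  As the reflection only changes the sign of a coordinate, the involution preserves colours, and each
  monochrome subgraph of \<open>G\<close> is the double cover of its quotient that the gains describe.  Such
  a cover is connected iff the quotient contains a connected spanning unbalanced map graph
  (\<open>all_joined_iff_map_graph\<close>).  In one direction, walks lift, so that the cover of a connected graph
  has at most two components, and an unbalanced cycle lifts to a walk from a vertex to its
  opposite and merges them (\<open>joined_if_map_graph\<close>).  In the other direction, a minimal set of
  quotient edges whose cover is connected does the job: a shortest walk from a vertex to its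
  opposite projects to an unbalanced cycle (\<open>unbalanced_cycle_exists\<close>), and a further cycle would
  allow an edge to be removed (\<open>minimal_cover_unique_cycle\<close>).
\<close>

section \<open>Symmetric graphs as double covers of their quotients\<close>

locale free_symmetric_graph =
  fixes E :: "'v::finite set set" and \<theta> :: "int \<Rightarrow> 'v \<Rightarrow> 'v" and R :: "'v set"
  assumes symmetric: "symmetric_graph E \<theta>"
    and free: "free_action \<theta>"
    and representatives: "vertex_representatives \<theta> R"
begin

abbreviation opp :: "'v \<Rightarrow> 'v" where "opp \<equiv> \<theta> (-1)"
abbreviation orb :: "'v \<Rightarrow> 'v set" where "orb \<equiv> vertex_orbit \<theta>"
abbreviation Q :: "('v set, 'v set set) multigraph" where "Q \<equiv> quotient_graph E \<theta>"

lemma opp_opp [simp]: "opp (opp v) = v"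
proof -
  have hom: "\<theta> \<in> hom sign_img (graph_aut E)"
    using symmetric by (simp add: symmetric_graph_def)
  have m: "\<theta> (x * y) = \<theta> x \<circ> \<theta> y" if "x \<in> {-1, 1}" "y \<in> {-1, 1}" for x y
    using hom that by (auto simp: hom_def sign_img_def graph_aut_def)
  have "bij (\<theta> 1)"
    using hom by (auto simp: hom_def sign_img_def graph_aut_def)
  moreover have "\<theta> 1 (\<theta> 1 v) = \<theta> 1 v" using m[of 1 1] by (simp add: fun_eq_iff)
  ultimately have "\<theta> 1 v = v" by (metis bij_is_inj injD)
  then show ?thesis using m[of "-1" "-1"] by (simp add: fun_eq_iff)
qed

lemma opp_neq [simp]: "opp v \<noteq> v" "v \<noteq> opp v"
  using free by (auto simp: free_action_def dest: sym)

lemma opp_eq_iff [simp]: "opp v = opp w \<longleftrightarrow> v = w"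
  by (metis opp_opp)

lemma opp_edge: "{opp v, opp w} \<in> E \<longleftrightarrow> {v, w} \<in> E"
  using symmetric by (auto simp: symmetric_graph_def hom_def sign_img_def graph_aut_def)

lemma orb_eq_iff: "orb v = orb w \<longleftrightarrow> w = v \<or> w = opp v"
  by (auto simp: vertex_orbit_def doubleton_eq_iff)

lemma edge_obtain:
  assumes "e \<in> E" obtains x y where "e = {x, y}"
  using assms symmetric by (auto simp: symmetric_graph_def simple_graph_def card_2_iff)

lemma edge_orbit_pair: "edge_orbit \<theta> {x, y} = {{x, y}, {opp x, opp y}}"
  by (simp add: edge_orbit_def)

lemma edge_orbit_opp: "edge_orbit \<theta> {opp x, opp y} = edge_orbit \<theta> {x, y}"
  by (auto simp: edge_orbit_pair)

lemma ends_edge_orbit: "ends Q (edge_orbit \<theta> {x, y}) = {orb x, orb y}"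
proof -
  have [simp]: "orb (opp v) = orb v" for v by (simp add: orb_eq_iff)
  have "opp v = w \<longleftrightarrow> v = opp w" for v w by auto
  then show ?thesis
    by (auto simp: quotient_graph_def edge_orbit_pair)
qed

text \<open>
  Each edge determines the orbit that it lies in, so a lift of a quotient edge carries all the
  information on that edge.
\<close>

lemma in_edge_orbitD:
  assumes "b \<in> edges Q" "{x, y} \<in> b"
  shows "b = edge_orbit \<theta> {x, y}"
proof -
  obtain e where "e \<in> E" "b = edge_orbit \<theta> e" using assms by (auto simp: quotient_graph_def)
  moreover obtain v w where "e = {v, w}" using \<open>e \<in> E\<close> edge_obtain by blast
  ultimately have b: "b = edge_orbit \<theta> {v, w}" by simp
  then have "{x, y} = {v, w} \<or> {x, y} = {opp v, opp w}" using assms(2) by (simp add: edge_orbit_pair)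
  then show ?thesis using b edge_orbit_opp by metis
qed

text \<open>
  The representatives cut the double cover of the quotient into two sheets, which the involution
  exchanges.  An edge of the quotient has gain \<open>1\<close> iff its lifts stay within a sheet, so the gain
  is the coboundary of the sheet function: the product of the gains along the projection of a walk
  only depends on the sheets of its two endpoints.
\<close>

definition sheet :: "'v \<Rightarrow> int" where "sheet v = (if v \<in> R then 1 else -1)"

lemma opp_in_R: "opp v \<in> R \<longleftrightarrow> v \<notin> R"
proof -
  have "\<exists>!w. w \<in> R \<inter> {v, opp v}"
    using representatives by (auto simp: vertex_representatives_def vertex_orbit_def)
  then have "\<not> (v \<in> R \<and> opp v \<in> R)" "v \<in> R \<or> opp v \<in> R"
    using opp_neq(1)[of v] by blast+
  then show ?thesis by blast
qed

lemma sheet_opp [simp]: "sheet (opp v) = - sheet v"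
  by (simp add: sheet_def opp_in_R)

lemma sheet_sq [simp]: "sheet v * sheet v = 1"
  by (simp add: sheet_def)

lemma sheet_cases: "sheet v = 1 \<or> sheet v = -1" by (simp add: sheet_def)

lemma gain_edge_orbit: "gain R (edge_orbit \<theta> {x, y}) = sheet x * sheet y"
  by (auto simp: gain_def edge_orbit_pair sheet_def opp_in_R)

text \<open>
  Two vertices in one orbit are told apart by their sheets.
\<close>

lemma same_sheet:
  assumes "orb y = orb x"
  shows "y = (if sheet x * sheet y = 1 then x else opp x)"
  using assms by (auto simp: orb_eq_iff)

text \<open>
  Reachability in the double cover: a quotient edge is the set of its lifts, so \<open>\<Union>S\<close> is the set of
  all lifts of edges in \<open>S\<close>.
\<close>

definition joined :: "'v set set set \<Rightarrow> 'v \<Rightarrow> 'v \<Rightarrow> bool" where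
  "joined S = (\<lambda>x y. {x, y} \<in> \<Union>S)\<^sup>*\<^sup>*"

lemma joined_refl [simp]: "joined S x x" by (simp add: joined_def)

lemma joined_edge: "b \<in> S \<Longrightarrow> {x, y} \<in> b \<Longrightarrow> joined S x y"
  by (auto simp: joined_def)

lemma joined_trans: "joined S x y \<Longrightarrow> joined S y z \<Longrightarrow> joined S x z"
  unfolding joined_def by (rule rtranclp_trans)

lemma joined_sym: "joined S x y \<Longrightarrow> joined S y x"
  unfolding joined_def by (rule sympD[OF symp_rtranclp]) (auto simp: symp_def insert_commute)

lemma joined_mono: "joined S x y \<Longrightarrow> S \<subseteq> S' \<Longrightarrow> joined S' x y"
  unfolding joined_def by (erule rtranclp_mono[THEN predicate2D, rotated]) auto

lemma joined_opp:
  assumes S: "S \<subseteq> edges Q" and "joined S x y"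
  shows "joined S (opp x) (opp y)"
  using assms(2) unfolding joined_def
proof (induction rule: rtranclp_induct)
  case (step y z)
  then obtain b where b: "b \<in> S" "{y, z} \<in> b" by auto
  then have "b = edge_orbit \<theta> {y, z}" using S in_edge_orbitD by blast
  then have "{opp y, opp z} \<in> \<Union>S" using b by (auto simp: edge_orbit_pair)
  then show ?case using step by (auto intro: rtranclp.rtrancl_into_rtrancl)
qed simp

text \<open>
  The path lifting property of the cover: of the two lifts of a quotient edge (or, for a loop, the
  only lift), at least one starts at the given vertex over its end.
\<close>

lemma lift_edge:
  assumes "b \<in> edges Q" "ends Q b = {orb x, B}"
  obtains y where "orb y = B" "b = edge_orbit \<theta> {x, y}" "{x, y} \<in> b"
proof -
  obtain e where "e \<in> E" "b = edge_orbit \<theta> e" using assms by (auto simp: quotient_graph_def)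
  moreover obtain v w where "e = {v, w}" using \<open>e \<in> E\<close> edge_obtain by blast
  ultimately have b: "b = edge_orbit \<theta> {v, w}" by simp
  have "{orb v, orb w} = {orb x, B}" using assms(2) b ends_edge_orbit by simp
  then obtain v' w' where vw: "{v, w} = {v', w'}" "orb v' = orb x" "orb w' = B"
    by (auto simp: doubleton_eq_iff)
  show thesis
  proof (cases "v' = x")
    case True
    then show ?thesis using that[of w'] vw b by (auto simp: edge_orbit_def)
  next
    case False
    then have "v' = opp x" using vw(2) orb_eq_iff by metis
    then show ?thesis using that[of "opp w'"] vw b edge_orbit_opp[of x "opp w'"] orb_eq_iff
      by (auto simp: edge_orbit_pair)
  qed
qed

lemma lift_walk:
  assumes S: "S \<subseteq> edges Q"
    and "\<And>i. i < k \<Longrightarrow> es i \<in> S"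
    and "\<And>i. i < k \<Longrightarrow> ends Q (es i) = {vs i, vs (Suc i)}"
    and "orb x = vs 0"
  shows "\<exists>y. orb y = vs k \<and> joined S x y \<and> sheet x * sheet y = (\<Prod>i<k. gain R (es i))"
  using assms(2,3)
proof (induction k)
  case 0
  then show ?case using assms(4) by (intro exI[of _ x]) simp
next
  case (Suc k)
  then obtain y where y: "orb y = vs k" "joined S x y" "sheet x * sheet y = (\<Prod>i<k. gain R (es i))"
    by (meson less_SucI)
  have "es k \<in> edges Q" using Suc.prems(1) S by blast
  then obtain z where z: "orb z = vs (Suc k)" "es k = edge_orbit \<theta> {y, z}" "{y, z} \<in> es k"
    using lift_edge Suc.prems(2)[of k] y(1) by (metis lessI)
  have "sheet x * sheet z = (sheet x * sheet y) * (sheet y * sheet z)"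
    using sheet_cases[of y] by auto
  then have "sheet x * sheet z = (\<Prod>i<Suc k. gain R (es i))"
    using y(3) z(2) gain_edge_orbit by simp
  moreover have "joined S x z"
    using joined_trans[OF y(2) joined_edge[OF _ z(3)]] Suc.prems(1) by simp
  ultimately show ?case using z(1) by blast
qed

lemma prod_gain_nth:
  assumes "distinct es"
  shows "prod f (set es) = (\<Prod>i<length es. f (es ! i))"
  using prod.reindex_bij_betw[OF bij_betw_nth[OF assms refl refl], of f] by simp

text \<open>
  Lifting a closed walk of gain \<open>-1\<close> leads to the other sheet, hence from a vertex to its opposite.
\<close>

lemma unbalanced_cycle_joins:
  assumes C: "is_cycle Q C" "C \<subseteq> edges Q" and "prod (gain R) C \<noteq> 1"
  obtains x where "joined C x (opp x)"
proof -
  obtain vs es where c: "es \<noteq> []" "length vs = length es" "distinct es" "set vs \<subseteq> verts Q"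
    "\<And>i. i < length es \<Longrightarrow> ends Q (es ! i) = {vs ! i, vs ! (Suc i mod length es)}" "C = set es"
    using C(1) unfolding is_cycle_def by blast
  let ?n = "length es"
  have "vs ! 0 \<in> verts Q" using c by (metis length_greater_0_conv nth_mem subsetD)
  then obtain x where x: "orb x = vs ! (0 mod ?n)" by (auto simp: quotient_graph_def)
  obtain y where y: "orb y = vs ! (?n mod ?n)" "joined C x y"
    "sheet x * sheet y = (\<Prod>i<?n. gain R (es ! i))"
    using lift_walk[OF C(2), of ?n "(!) es" "\<lambda>i. vs ! (i mod ?n)" x] c x by auto
  have "y = opp x"
    using same_sheet[of y x] y x assms(3) c prod_gain_nth[of es "gain R"] by auto
  then show thesis using that y by blast
qed

text \<open>
  A cycle without one of its edges is a walk between the ends of that edge.  The lift of this walk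
  bypasses the lifted edge up to the involution.  If the cycle is balanced, the walk has the same
  gain as the edge, so its lift ends on the same sheet as the lifted edge.
\<close>

lemma cycle_bypass:
  assumes C: "is_cycle Q C" "C \<subseteq> edges Q" and b: "edge_orbit \<theta> {x, y} \<in> C"
  obtains z where "z = y \<or> z = opp y" "joined (C - {edge_orbit \<theta> {x, y}}) x z"
    "prod (gain R) C = 1 \<Longrightarrow> z = y"
proof -
  let ?b = "edge_orbit \<theta> {x, y}" and ?j = "joined (C - {edge_orbit \<theta> {x, y}})"
  obtain vs es where c: "es \<noteq> []" "length vs = length es" "distinct es"
    "\<And>i. i < length es \<Longrightarrow> ends Q (es ! i) = {vs ! i, vs ! (Suc i mod length es)}" "C = set es"
    using C(1) unfolding is_cycle_def by blast
  let ?n = "length es"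
  obtain m where m: "m < ?n" "es ! m = ?b" using b c by (auto simp: in_set_conv_nth)
  define k where "k = ?n - 1"
  have n: "?n = Suc k" using c by (simp add: k_def)
  \<comment> \<open>The cycle is rotated so that the edge to be avoided comes last.\<close>
  define es' where "es' = rotate (Suc m) es"
  define w where "w i = vs ! ((Suc m + i) mod ?n)" for i
  have nth': "es' ! i = es ! ((Suc m + i) mod ?n)" if "i < ?n" for i
    using that by (simp add: es'_def nth_rotate del: rotate_Suc)
  have es': "length es' = ?n" "distinct es'" "set es' = C"
    using c by (simp_all add: es'_def)
  have ends': "ends Q (es' ! i) = {w i, w (Suc i)}" if "i < ?n" for i
  proof -
    have "(Suc m + i) mod ?n < ?n" using n by simp
    then show ?thesis using c(4) nth'[OF that] by (simp add: w_def mod_Suc_eq)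
  qed
  have last: "es' ! k = ?b"
  proof -
    have "(Suc m + k) mod ?n = m" using n m(1) by (metis add_Suc_shift mod_add_self2 mod_less)
    then show ?thesis using nth'[of k] n m(2) by simp
  qed
  have w_n: "w (Suc k) = w 0" unfolding w_def using n by (metis add.right_neutral mod_add_self2)
  have inC: "es' ! i \<in> C - {?b}" if "i < k" for i
    using that es' last n by (metis DiffI lessI less_SucI less_not_refl nth_eq_iff_index_eq nth_mem singletonD)
  have prodC: "prod (gain R) C = (\<Prod>i<k. gain R (es' ! i)) * (sheet x * sheet y)"
    using prod_gain_nth[OF es'(2), of "gain R"] es' n last gain_edge_orbit by simp
  have lift: "\<exists>v. orb v = w k \<and> ?j u v \<and> sheet u * sheet v = (\<Prod>i<k. gain R (es' ! i))"
    if "orb u = w 0" for u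
    using that C(2) inC ends' n
    by (intro lift_walk[where vs = w and es = "(!) es'"]) auto
  have "{orb x, orb y} = {w k, w 0}"
    using ends'[of k] last w_n n ends_edge_orbit by simp
  then consider "orb x = w 0" "orb y = w k" | "orb y = w 0" "orb x = w k"
    by (auto simp: doubleton_eq_iff)
  then show thesis
  proof cases
    case 1
    then obtain v where v: "orb v = orb y" "?j x v" "sheet x * sheet v = (\<Prod>i<k. gain R (es' ! i))"
      using lift by metis
    have "v = y" if "prod (gain R) C = 1"
      using that same_sheet[OF v(1)] prodC v(3)[symmetric] sheet_cases[of x]
      by (auto simp: mult.commute)
    then show ?thesis using that[of v] v(1,2) orb_eq_iff by metis
  next
    case 2
    then obtain v where v: "orb v = orb x" "?j y v" "sheet y * sheet v = (\<Prod>i<k. gain R (es' ! i))"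
      using lift by metis
    show ?thesis
    proof (cases "v = x")
      case True
      then show ?thesis using that[of y] joined_sym v(2) by blast
    next
      case False
      then have vx: "v = opp x" using v(1) orb_eq_iff by metis
      then have "?j (opp x) y" using v(2) joined_sym by blast
      then have "?j x (opp y)"
        using joined_opp[of "C - {?b}" "opp x" y] C(2) by auto
      moreover have "prod (gain R) C \<noteq> 1"
        using prodC v(3)[symmetric] vx sheet_cases[of x] sheet_cases[of y] by auto
      ultimately show ?thesis using that[of "opp y"] by blast
    qed
  qed
qed

text \<open>
  A cover of a connected graph has at most two components, which the involution permutes; one
  vertex joined to its opposite merges them.
\<close>

lemma all_joined:
  assumes up_to_opp: "\<And>x y. joined S x y \<or> joined S x (opp y)"
    and v: "joined S v (opp v)"
  shows "joined S x y"
proof -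
  have "joined S z v" for z using up_to_opp[of z v] joined_sym[OF v] joined_trans by blast
  then show ?thesis using joined_sym joined_trans by blast
qed

text \<open>
  Among all walks that lead from some vertex to its opposite, a shortest one projects to a cycle:
  if it met an orbit twice, either a part of it would already lead from a vertex to its opposite,
  or a closed part could be cut out.  The gain of the cycle is \<open>-1\<close> because the walk changes
  sheets.
\<close>

lemma unbalanced_cycle_exists:
  assumes S: "S \<subseteq> edges Q" and "joined S v (opp v)"
  obtains C where "C \<subseteq> S" "is_cycle Q C" "prod (gain R) C \<noteq> 1"
proof -
  let ?r = "\<lambda>x y. {x, y} \<in> \<Union>S"
  let ?P = "\<lambda>n. \<exists>x. (?r ^^ n) x (opp x)"
  define n where "n = (LEAST n. ?P n)"
  have "\<exists>n. ?P n" using assms(2) unfolding joined_def by (metis rtranclp_power)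
  then have "?P n" unfolding n_def by (rule LeastI_ex)
  then obtain f where f: "f n = opp (f 0)" "\<And>i. i < n \<Longrightarrow> {f i, f (Suc i)} \<in> \<Union>S"
    by (auto simp: relpowp_fun_conv)
  have least: "n \<le> m" if "?P m" for m using that unfolding n_def by (rule Least_le)
  have sub: "(?r ^^ (j - i)) (f i) (f j)" if "i \<le> j" "j \<le> n" for i j
    unfolding relpowp_fun_conv using that f by (intro exI[of _ "\<lambda>k. f (i + k)"]) auto
  have n0: "n > 0" using f(1) opp_neq by (cases n) auto
  have inj: "i = 0 \<and> j = n" if "i < j" "j \<le> n" "orb (f i) = orb (f j)" for i j
  proof -
    consider "f j = f i" | "f j = opp (f i)" using \<open>orb (f i) = orb (f j)\<close> orb_eq_iff by blast
    then show ?thesis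
    proof cases
      case 1
      have "(?r ^^ ((i - 0) + (n - j))) (f 0) (f n)"
        using sub[of 0 i] sub[of j n] that 1 unfolding relpowp_add by auto
      then have "n \<le> (i - 0) + (n - j)" using least f(1) by metis
      then show ?thesis using that by simp
    next
      case 2
      then have "n \<le> j - i" using least[of "j - i"] sub[of i j] that by auto
      then show ?thesis using \<open>i < j\<close> \<open>j \<le> n\<close> by auto
    qed
  qed
  define vs where "vs = map (\<lambda>i. orb (f i)) [0..<n]"
  define e where "e i = edge_orbit \<theta> {f i, f (Suc i)}" for i
  define es where "es = map e [0..<n]"
  have eS: "e i \<in> S" if "i < n" for i
  proof -
    obtain b where b: "b \<in> S" "{f i, f (Suc i)} \<in> b" using f(2)[of i] \<open>i < n\<close> by blast
    then have "b = e i" using in_edge_orbitD S by (auto simp: e_def)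
    then show ?thesis using b(1) by simp
  qed
  have ends_e: "ends Q (e i) = {orb (f i), orb (f (Suc i))}" for i
    by (simp add: e_def ends_edge_orbit)
  have gain_e: "gain R (e i) = sheet (f i) * sheet (f (Suc i))" for i
    by (simp add: e_def gain_edge_orbit)
  have orb_n: "orb (f n) = orb (f 0)" using f(1) orb_eq_iff by auto
  \<comment> \<open>Two steps over the same quotient edge are only possible for \<open>n = 2\<close>, as all vertices
    of the cycle are distinct; the gains then differ, since the two steps together change sheets.\<close>
  have "e i \<noteq> e j" if "i < j" "j < n" for i j
  proof
    assume eq: "e i = e j"
    have "orb (f i) \<noteq> orb (f j)" using inj[of i j] that by auto
    moreover have "{orb (f i), orb (f (Suc i))} = {orb (f j), orb (f (Suc j))}"
      using eq ends_e by metis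
    ultimately have "orb (f i) = orb (f (Suc j))" "orb (f (Suc i)) = orb (f j)"
      by (auto simp: doubleton_eq_iff)
    then have "i = 0" "Suc j = n" "Suc i = j"
      using inj[of i "Suc j"] inj[of "Suc i" j] that by force+
    then show False
      using eq gain_e[of i] gain_e[of j] f(1) sheet_cases[of "f 0"] sheet_cases[of "f 1"] by auto
  qed
  then have "inj_on e {..<n}" by (intro linorder_inj_onI) auto
  then have d: "distinct es" by (simp add: es_def distinct_map lessThan_atLeast0)
  have "inj_on (\<lambda>i. orb (f i)) {..<n}"
    using inj by (intro linorder_inj_onI) force+
  then have "distinct vs" by (simp add: vs_def distinct_map lessThan_atLeast0)
  moreover have "ends Q (es ! i) = {vs ! i, vs ! (Suc i mod length es)}" if "i < length es" for i
    using that ends_e[of i] orb_n by (cases "Suc i = n") (auto simp: es_def vs_def)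
  moreover have "set es \<subseteq> S" using eS by (auto simp: es_def)
  moreover have "set vs \<subseteq> verts Q" by (auto simp: vs_def quotient_graph_def)
  moreover have "length vs = length es" "es \<noteq> []" using n0 by (simp_all add: vs_def es_def)
  ultimately have cyc: "is_cycle Q (set es)"
    unfolding is_cycle_def using d S by (intro exI[of _ vs] exI[of _ es]) auto
  have "(\<Prod>i<k. sheet (f i) * sheet (f (Suc i))) = sheet (f 0) * sheet (f k)" for k
  proof (induction k)
    case (Suc k)
    then show ?case using sheet_cases[of "f k"] by auto
  qed simp
  then have "prod (gain R) (set es) = -1"
    using prod_gain_nth[OF d, of "gain R"] f(1) gain_e by (simp add: es_def)
  then show thesis using that[of "set es"] cyc \<open>set es \<subseteq> S\<close> by simp
qed

section \<open>Connected covers and unbalanced map graphs\<close>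

text \<open>
  Removing an edge of a cycle keeps the quotient connected, which in the cover means connected up to
  the involution.  If the cycle is balanced, even the cover stays connected.
\<close>

lemma joined_remove:
  assumes S: "S \<subseteq> edges Q" and C: "is_cycle Q C" "C \<subseteq> S" and b: "b \<in> C"
    and "joined S x y"
  shows "joined (S - {b}) x y \<or> (prod (gain R) C \<noteq> 1 \<and> joined (S - {b}) x (opp y))"
  using assms(5) unfolding joined_def[of S]
proof (induction rule: rtranclp_induct)
  case (step y z)
  have S': "S - {b} \<subseteq> edges Q" using S by blast
  obtain c where c: "c \<in> S" "{y, z} \<in> c" using step(2) by blast
  have "joined (S - {b}) y z \<or> (prod (gain R) C \<noteq> 1 \<and> joined (S - {b}) y (opp z))"
  proof (cases "c = b")
    case True
    then have "b = edge_orbit \<theta> {y, z}" using in_edge_orbitD c S by blast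
    then obtain u where "u = z \<or> u = opp z" "joined (C - {b}) y u" "prod (gain R) C = 1 \<Longrightarrow> u = z"
      using cycle_bypass[OF C(1), of y z] b C(2) S by (metis order_trans)
    moreover from this have "joined (S - {b}) y u" using joined_mono C(2) by (meson Diff_mono order_refl)
    ultimately show ?thesis by auto
  next
    case False
    then show ?thesis using joined_edge[of c "S - {b}" y z] c by blast
  qed
  moreover have "joined (S - {b}) (opp y) (opp z)" if "joined (S - {b}) y z"
    using joined_opp[OF S' that] .
  moreover have "joined (S - {b}) (opp y) z" if "joined (S - {b}) y (opp z)"
    using joined_opp[OF S' that] by simp
  ultimately show ?case using step.IH joined_trans[of "S - {b}" x] by blast
qed simp

text \<open>
  If the cover is connected, some cycle is unbalanced.  Minimality rules out balanced cycles, because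
  any edge of a balanced cycle can be removed.  It also rules out two different unbalanced cycles:
  removing an edge of the first that does not lie on the second keeps the quotient connected and
  keeps an unbalanced cycle, so the cover would stay connected.
\<close>

lemma minimal_cover_unique_cycle:
  assumes S: "S \<subseteq> edges Q" and all: "\<And>x y. joined S x y"
    and min: "\<And>b. b \<in> S \<Longrightarrow> \<exists>x y. \<not> joined (S - {b}) x y"
  obtains C where "C \<subseteq> S" "is_cycle Q C" "prod (gain R) C \<noteq> 1"
    "\<And>D. D \<subseteq> S \<Longrightarrow> is_cycle Q D \<Longrightarrow> D = C"
proof -
  obtain C where C: "C \<subseteq> S" "is_cycle Q C" "prod (gain R) C \<noteq> 1"
    using unbalanced_cycle_exists[OF S all] by blast
  have unb: "prod (gain R) D \<noteq> 1" if D: "D \<subseteq> S" "is_cycle Q D" for D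
  proof
    assume p: "prod (gain R) D = 1"
    obtain b where b: "b \<in> D" using D(2) unfolding is_cycle_def by (metis all_not_in_conv set_empty)
    then show False using joined_remove[OF S D(2,1) b all] p min[of b] D(1) by blast
  qed
  have sub: "D \<subseteq> D'" if D: "D \<subseteq> S" "is_cycle Q D" and D': "D' \<subseteq> S" "is_cycle Q D'" for D D'
  proof
    fix b assume b: "b \<in> D"
    show "b \<in> D'"
    proof (rule ccontr)
      assume nb: "b \<notin> D'"
      obtain v where "joined D' v (opp v)"
        using unbalanced_cycle_joins[OF D'(2)] unb[OF D'] D'(1) S by blast
      then have v: "joined (S - {b}) v (opp v)" using joined_mono[of D' v "opp v" "S - {b}"] D'(1) nb
        by blast
      have "joined (S - {b}) x y \<or> joined (S - {b}) x (opp y)" for x y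
        using joined_remove[OF S D(2,1) b all] by fast
      then have "joined (S - {b}) x y" for x y
        using v by (rule all_joined)
      then show False using min b D(1) by blast
    qed
  qed
  have "D = C" if "D \<subseteq> S" "is_cycle Q D" for D
    using sub[OF that C(1,2)] sub[OF C(1,2) that] by (rule equalityI)
  with C show thesis by (rule that)
qed

lemma adjacent_if_joined:
  assumes S: "S \<subseteq> edges Q" and "joined S x y"
  shows "(adjacent \<lparr>verts = V, edges = S, ends = ends Q\<rparr>)\<^sup>*\<^sup>* (orb x) (orb y)"
  using assms(2) unfolding joined_def
proof (induction rule: rtranclp_induct)
  case (step y z)
  then obtain b where b: "b \<in> S" "{y, z} \<in> b" by auto
  then have "b = edge_orbit \<theta> {y, z}" using S in_edge_orbitD by blast
  then have "adjacent \<lparr>verts = V, edges = S, ends = ends Q\<rparr> (orb y) (orb z)"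
    using b ends_edge_orbit[of y z] by (auto simp: adjacent_def)
  then show ?case using step by (auto intro: rtranclp.rtrancl_into_rtrancl)
qed simp

text \<open>
  Walks in \<open>H\<close> lift, so the cover has at most two components, and the unbalanced cycle merges them.
\<close>

lemma joined_if_map_graph:
  assumes M: "M \<subseteq> edges Q"
    and H: "subgraph_of H \<lparr>verts = V, edges = M, ends = ends Q\<rparr>"
    and con: "connected_graph H" and span: "spanning_in Q H"
    and map: "unbalanced_map_graph Q (gain R) H"
  shows "joined M x y"
proof -
  have vH: "verts H = range orb" using span by (simp add: spanning_in_def quotient_graph_def)
  have eH: "edges H \<subseteq> M" "\<And>e. e \<in> edges H \<Longrightarrow> ends H e = ends Q e"
    using H by (auto simp: subgraph_of_def)
  have lift: "\<exists>z. orb z = B \<and> joined M x z" if "(adjacent H)\<^sup>*\<^sup>* (orb x) B" for x B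
    using that
  proof (induction rule: rtranclp_induct)
    case base
    then show ?case by (intro exI[of _ x]) simp
  next
    case (step B B')
    then obtain z where z: "orb z = B" "joined M x z" by blast
    obtain e where e: "e \<in> edges H" "ends H e = {B, B'}"
      using step(2) by (auto simp: adjacent_def)
    then have "e \<in> edges Q" "ends Q e = {orb z, B'}" using eH M z(1) by auto
    then obtain w where "orb w = B'" "{z, w} \<in> e" by (rule lift_edge)
    moreover have "e \<in> M" using e(1) eH(1) by blast
    ultimately show ?case using joined_trans[OF z(2) joined_edge[of e M z w]] by blast
  qed
  have pair: "joined M x y \<or> joined M x (opp y)" for x y
  proof -
    have "(adjacent H)\<^sup>*\<^sup>* (orb x) (orb y)"
      using con vH by (auto simp: connected_graph_def)
    then show ?thesis using lift orb_eq_iff by metis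
  qed
  obtain v :: 'v where True by simp
  let ?K = "graph_component H (orb v)"
  have "?K \<in> graph_components H" using vH by (auto simp: graph_components_def)
  then obtain D where D: "is_cycle ?K D" "\<not> balanced Q (gain R) D"
    using map unfolding unbalanced_map_graph_def by blast
  obtain C where C: "C \<subseteq> D" "is_cycle Q C" "prod (gain R) C \<noteq> 1"
    using D(2) unfolding balanced_def by blast
  have "D \<subseteq> edges ?K" using D(1) by (auto simp: is_cycle_def)
  also have "\<dots> \<subseteq> edges H" by (auto simp: graph_component_def Let_def)
  finally have "C \<subseteq> M" using C(1) eH(1) by blast
  then obtain u where "joined C u (opp u)"
    using unbalanced_cycle_joins[OF C(2) _ C(3)] M by blast
  then have "joined M u (opp u)" using joined_mono \<open>C \<subseteq> M\<close> by blast
  with pair show ?thesis by (rule all_joined)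
qed

text \<open>
  The map graph consists of a minimal set of edges whose lifts connect the cover.
\<close>

lemma map_graph_if_joined:
  assumes M: "M \<subseteq> edges Q" and all: "\<And>x y. joined M x y"
  obtains H where "subgraph_of H \<lparr>verts = \<Union> (ends Q ` M), edges = M, ends = ends Q\<rparr>"
    "connected_graph H" "spanning_in Q H" "unbalanced_map_graph Q (gain R) H"
proof -
  let ?good = "\<lambda>S. S \<subseteq> M \<and> (\<forall>x y. joined S x y)"
  have "finite (Collect ?good)" "Collect ?good \<noteq> {}" using all by auto
  then obtain S where S: "S \<in> Collect ?good"
    and S_min: "\<forall>S'\<in>Collect ?good. S' \<subseteq> S \<longrightarrow> S = S'"
    using finite_has_minimal by meson
  then have S: "?good S" by simp
  have least: "S' = S" if "?good S'" "S' \<subseteq> S" for S'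
  proof -
    have "S' \<in> Collect ?good" using that(1) by (rule CollectI)
    then show ?thesis using S_min that(2) by metis
  qed
  have min: "\<exists>x y. \<not> joined (S - {b}) x y" if "b \<in> S" for b
  proof (rule ccontr)
    assume "\<not> ?thesis"
    then have "?good (S - {b})" using S by blast
    then have "S - {b} = S" by (rule least) blast
    then show False using that by blast
  qed
  have SQ: "S \<subseteq> edges Q" using S M by blast
  obtain C where C: "C \<subseteq> S" "is_cycle Q C" "prod (gain R) C \<noteq> 1"
    and uniq: "\<And>D. D \<subseteq> S \<Longrightarrow> is_cycle Q D \<Longrightarrow> D = C"
    using minimal_cover_unique_cycle[OF SQ] S min by metis
  define H where "H = \<lparr>verts = verts Q, edges = S, ends = ends Q\<rparr>"
  \<comment> \<open>No vertex is isolated, since it is joined to its opposite, which is a different vertex.\<close>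
  have orbM: "orb v \<in> \<Union> (ends Q ` M)" for v
  proof -
    have "joined M v (opp v)" by (rule all)
    then obtain w where "{v, w} \<in> \<Union>M"
      unfolding joined_def by (cases rule: converse_rtranclpE) auto
    then obtain b where b: "b \<in> M" "{v, w} \<in> b" by blast
    then have "b = edge_orbit \<theta> {v, w}" using M in_edge_orbitD by blast
    then show ?thesis using b(1) ends_edge_orbit by blast
  qed
  have ends_V: "ends Q e \<subseteq> verts Q" for e by (auto simp: quotient_graph_def)
  have sub: "subgraph_of H \<lparr>verts = V, edges = M, ends = ends Q\<rparr>" if "verts Q \<subseteq> V" for V
    using that S ends_V by (auto simp: subgraph_of_def H_def)
  have con: "(adjacent H)\<^sup>*\<^sup>* a b" if ab: "a \<in> verts H" "b \<in> verts H" for a b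
  proof -
    obtain x y where "a = orb x" "b = orb y" using ab by (auto simp: H_def quotient_graph_def)
    then show ?thesis using adjacent_if_joined[OF SQ] S unfolding H_def by blast
  qed
  have K: "K = H" if "K \<in> graph_components H" for K
    using that con ends_V by (auto simp: graph_components_def graph_component_def Let_def H_def)
  have cyc: "is_cycle H D \<longleftrightarrow> D \<subseteq> S \<and> is_cycle Q D" for D
  proof
    assume "is_cycle H D"
    then obtain vs es where c: "es \<noteq> [] \<and> length vs = length es \<and> distinct vs \<and> distinct es \<and>
      set vs \<subseteq> verts Q \<and> set es \<subseteq> S \<and>
      (\<forall>i<length es. ends Q (es ! i) = {vs ! i, vs ! (Suc i mod length es)}) \<and> D = set es"
      unfolding is_cycle_def H_def by auto
    then show "D \<subseteq> S \<and> is_cycle Q D"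
      using SQ unfolding is_cycle_def by (intro conjI exI[of _ vs] exI[of _ es]) auto
  next
    assume "D \<subseteq> S \<and> is_cycle Q D"
    then obtain vs es where "es \<noteq> [] \<and> length vs = length es \<and> distinct vs \<and> distinct es \<and>
      set vs \<subseteq> verts Q \<and> set es \<subseteq> S \<and>
      (\<forall>i<length es. ends Q (es ! i) = {vs ! i, vs ! (Suc i mod length es)}) \<and> D = set es"
      unfolding is_cycle_def by auto
    then show "is_cycle H D"
      unfolding is_cycle_def H_def by (intro exI[of _ vs] exI[of _ es]) auto
  qed
  have "\<not> balanced Q (gain R) C" using C by (auto simp: balanced_def)
  moreover have "D = C" if "is_cycle H D" for D using that cyc uniq by blast
  moreover have "is_cycle H C" using cyc C by blast
  ultimately have "(\<exists>!C. is_cycle H C) \<and> (\<forall>C. is_cycle H C \<longrightarrow> \<not> balanced Q (gain R) C)"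
    by metis
  moreover have "subgraph_of H Q" using SQ ends_V by (auto simp: subgraph_of_def H_def)
  ultimately have "unbalanced_map_graph Q (gain R) H"
    unfolding unbalanced_map_graph_def using K by metis
  moreover have "verts Q \<subseteq> \<Union> (ends Q ` M)" using orbM by (auto simp: quotient_graph_def)
  ultimately show thesis
    using that[of H] sub con by (auto simp: connected_graph_def spanning_in_def H_def)
qed

lemma all_joined_iff_map_graph:
  assumes "M \<subseteq> edges Q"
  shows "(\<forall>x y. joined M x y) \<longleftrightarrow>
    (\<exists>H. subgraph_of H \<lparr>verts = \<Union> (ends Q ` M), edges = M, ends = ends Q\<rparr> \<and>
       connected_graph H \<and> spanning_in Q H \<and> unbalanced_map_graph Q (gain R) H)"
  using joined_if_map_graph[OF assms] map_graph_if_joined[OF assms] by metis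

end


section \<open>Flexes in a quadrilateral norm\<close>

text \<open>
  By symmetry the derivative would have to be \<open>0\<close>, but all difference quotients have absolute value \<open>1\<close>.
\<close>

lemma abs_not_differentiable: "\<not> (abs :: real \<Rightarrow> real) differentiable (at 0)"
proof
  assume "(abs :: real \<Rightarrow> real) differentiable (at 0)"
  then obtain D where D: "((abs :: real \<Rightarrow> real) has_real_derivative D) (at 0)"
    by (auto simp: real_differentiable_def)
  have "((\<lambda>t. - t) has_real_derivative - 1) (at (0::real))"
    by (rule DERIV_minus[OF DERIV_ident])
  moreover have "(abs has_real_derivative D) (at (- 0 :: real))" using D by simp
  ultimately have "((\<lambda>t::real. \<bar>- t\<bar>) has_real_derivative D * (- 1)) (at 0)"
    by (rule DERIV_chain2[of abs D uminus 0 "- 1" UNIV, rotated])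
  then have "(abs has_real_derivative - D) (at (0::real))" by simp
  with D have "D = - D" by (rule DERIV_unique)
  then have "D = 0" by simp
  then have "((\<lambda>h::real. \<bar>h\<bar> / h) \<longlongrightarrow> 0) (at 0)" using D by (simp add: DERIV_def)
  then have "((\<lambda>h::real. \<bar>\<bar>h\<bar> / h\<bar>) \<longlongrightarrow> 0) (at 0)" by (rule tendsto_rabs_zero)
  moreover have "\<forall>\<^sub>F h::real in at 0. \<bar>\<bar>h\<bar> / h\<bar> = 1"
    by (auto simp: eventually_at_filter)
  ultimately have "((\<lambda>h::real. 1 :: real) \<longlongrightarrow> 0) (at 0)"
    by (rule Lim_transform_eventually)
  then have "(1::real) = 0" by (rule LIM_const_eq)
  then show False by simp
qed

text \<open>
  The functionals \<open>a\<close> and \<open>b\<close> play symmetric roles, so every statement that is proved below for the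
  coordinate \<open>a\<close> also holds for \<open>b\<close>, by way of \<open>swap\<close>.
\<close>

locale quadrilateral =
  fixes N :: "real ^ 2 \<Rightarrow> real" and a b :: "real ^ 2"
  assumes norm: "is_norm N"
    and N_max: "N x = max \<bar>a \<bullet> x\<bar> \<bar>b \<bullet> x\<bar>"
begin

lemma swap: "quadrilateral N b a"
  by unfold_locales (simp_all add: norm N_max max.commute)

lemma coords_zero: "a \<bullet> x = 0 \<Longrightarrow> b \<bullet> x = 0 \<Longrightarrow> x = 0"
  using N_max[of x] norm by (auto simp: is_norm_def)

lemma coords_surj: obtains x where "a \<bullet> x = s" "b \<bullet> x = t"
proof -
  define f :: "real ^ 2 \<Rightarrow> real ^ 2" where "f x = (\<chi> i. if i = 1 then a \<bullet> x else b \<bullet> x)" for x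
  have f12: "f x $ 1 = a \<bullet> x" "f x $ 2 = b \<bullet> x" for x
    by (simp_all add: f_def)
  have "linear f"
    by (rule linearI) (simp_all add: f_def vec_eq_iff inner_add_right)
  moreover have "x = 0" if "f x = 0" for x
    using coords_zero[of x] f12[of x] that by simp
  ultimately have "surj f"
    by (simp add: linear_injective_imp_surjective linear_injective_0)
  then obtain x where "f x = (\<chi> i. if i = 1 then s else t)" by (metis surjD)
  then have "f x $ 1 = s" "f x $ 2 = t" by simp_all
  then show thesis using that f12 by metis
qed

text \<open>
  Where \<open>\<bar>a \<bullet> x\<bar>\<close> is strictly larger than \<open>\<bar>b \<bullet> x\<bar>\<close>, the norm is locally the linear functional
  \<open>a\<close> up to sign.  The curve is arbitrary because the lemma serves both for straight lines
  (infinitesimal flexes) and for the differences of two paths of a rigid motion.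
\<close>

lemma N_derivative:
  assumes g: "(g has_vector_derivative h) (at 0)"
    and less: "\<bar>b \<bullet> g 0\<bar> < \<bar>a \<bullet> g 0\<bar>"
  shows "((\<lambda>t. N (g t)) has_real_derivative sgn (a \<bullet> g 0) * (a \<bullet> h)) (at 0)"
proof -
  let ?s = "sgn (a \<bullet> g 0)"
  have cont: "isCont g 0"
    using g has_vector_derivative_continuous by blast
  have a0: "a \<bullet> g 0 \<noteq> 0" using less by auto
  have "((\<lambda>t. ?s * (a \<bullet> g t)) \<longlongrightarrow> ?s * (a \<bullet> g 0)) (at 0)"
    using cont by (intro tendsto_intros) (simp add: isCont_def)
  moreover have "((\<lambda>t. \<bar>b \<bullet> g t\<bar>) \<longlongrightarrow> \<bar>b \<bullet> g 0\<bar>) (at 0)"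
    using cont by (intro tendsto_intros) (simp add: isCont_def)
  ultimately have "((\<lambda>t. ?s * (a \<bullet> g t) - \<bar>b \<bullet> g t\<bar>) \<longlongrightarrow> ?s * (a \<bullet> g 0) - \<bar>b \<bullet> g 0\<bar>) (at 0)"
    by (rule tendsto_diff)
  moreover have "?s * (a \<bullet> g 0) - \<bar>b \<bullet> g 0\<bar> > 0"
    using less by (simp add: abs_sgn[of "a \<bullet> g 0"] mult.commute)
  ultimately have "\<forall>\<^sub>F t in at 0. ?s * (a \<bullet> g t) - \<bar>b \<bullet> g t\<bar> > 0"
    by (rule order_tendstoD)
  then have ev: "\<forall>\<^sub>F t in at 0. ?s * (a \<bullet> g t) = N (g t)"
    by eventually_elim (use a0 in \<open>auto simp: N_max sgn_if split: if_splits\<close>)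
  have "((\<lambda>t. ?s * (a \<bullet> g t)) has_real_derivative ?s * (a \<bullet> h)) (at 0)"
    using g by (auto intro!: derivative_eq_intros simp: has_vector_derivative_def has_field_derivative_def algebra_simps)
  moreover have "?s * (a \<bullet> g 0) = N (g 0)"
    using less by (auto simp: N_max sgn_if)
  ultimately show ?thesis
    using has_field_derivative_cong_eventually[OF ev] by blast
qed

text \<open>
  At a point where \<open>\<bar>a \<bullet> d\<bar> = \<bar>b \<bullet> d\<bar> = c\<close>, moving in a direction that increases one absolute value
  and decreases the other at unit speed gives norm \<open>c + \<bar>t\<bar>\<close>, which has a kink at \<open>0\<close>.
\<close>

lemma not_differentiable_tie:
  assumes d: "d \<noteq> 0" and diff: "\<And>u. (\<lambda>t. N (d + t *\<^sub>R u)) differentiable (at 0)"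
  shows "\<bar>a \<bullet> d\<bar> \<noteq> \<bar>b \<bullet> d\<bar>"
proof
  assume eq: "\<bar>a \<bullet> d\<bar> = \<bar>b \<bullet> d\<bar>"
  then have nz: "a \<bullet> d \<noteq> 0" "b \<bullet> d \<noteq> 0" using coords_zero[of d] d by auto
  obtain u where u: "a \<bullet> u = sgn (a \<bullet> d)" "b \<bullet> u = - sgn (b \<bullet> d)"
    using coords_surj by blast
  define c where "c = \<bar>a \<bullet> d\<bar>"
  have c: "c > 0" using nz by (simp add: c_def)
  have "\<bar>t\<bar> = N (d + t *\<^sub>R u) - c" for t
  proof -
    have "\<bar>a \<bullet> d + t * sgn (a \<bullet> d)\<bar> = \<bar>c + t\<bar>" "\<bar>b \<bullet> d - t * sgn (b \<bullet> d)\<bar> = \<bar>c - t\<bar>"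
      using nz eq by (auto simp: c_def sgn_if abs_if)
    then show ?thesis using c by (simp add: N_max inner_add_right u)
  qed
  then have "abs = (\<lambda>t. N (d + t *\<^sub>R u) - c)" by (rule ext)
  moreover have "(\<lambda>t. N (d + t *\<^sub>R u) - c) differentiable (at 0)"
    using diff by (intro derivative_intros)
  ultimately show False
    using abs_not_differentiable by metis
qed

lemma cone_facet:
  assumes F: "F = {x. N x \<le> 1 \<and> a \<bullet> x = 1}"
  shows "x \<in> cone hull F \<union> cone hull (uminus ` F) \<longleftrightarrow> \<bar>b \<bullet> x\<bar> \<le> \<bar>a \<bullet> x\<bar>"
proof
  assume "x \<in> cone hull F \<union> cone hull (uminus ` F)"
  then obtain c y where cy: "c \<ge> 0" "y \<in> F" "x = c *\<^sub>R y \<or> x = c *\<^sub>R (- y)"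
    unfolding cone_hull_expl by blast
  then have "\<bar>b \<bullet> y\<bar> \<le> \<bar>a \<bullet> y\<bar>" by (auto simp: F N_max)
  then show "\<bar>b \<bullet> x\<bar> \<le> \<bar>a \<bullet> x\<bar>" using cy by (auto simp: abs_mult mult_left_mono)
next
  assume le: "\<bar>b \<bullet> x\<bar> \<le> \<bar>a \<bullet> x\<bar>"
  show "x \<in> cone hull F \<union> cone hull (uminus ` F)"
  proof (cases "a \<bullet> x = 0")
    case True
    then have "x = 0" using le coords_zero by simp
    moreover obtain y where "a \<bullet> y = 1" "b \<bullet> y = 0" using coords_surj by blast
    then have "y \<in> F" by (simp add: F N_max)
    ultimately have "x \<in> cone hull F" unfolding cone_hull_expl
      by (auto intro!: exI[of _ 0] exI[of _ y])
    then show ?thesis by simp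
  next
    case False
    define y where "y = x /\<^sub>R (a \<bullet> x)"
    have "y \<in> F" using False le by (simp add: F y_def N_max abs_mult divide_simps)
    have x: "x = (a \<bullet> x) *\<^sub>R y" using False by (simp add: y_def)
    show ?thesis
    proof (cases "a \<bullet> x > 0")
      case True
      then have "x \<in> cone hull F"
        unfolding cone_hull_expl using x \<open>y \<in> F\<close> by (metis (mono_tags, lifting) less_imp_le mem_Collect_eq)
      then show ?thesis by simp
    next
      case False
      then have "x = (- (a \<bullet> x)) *\<^sub>R (- y)" "- (a \<bullet> x) \<ge> 0" "- y \<in> uminus ` F"
        using x \<open>y \<in> F\<close> by auto
      then have "x \<in> cone hull (uminus ` F)"
        unfolding cone_hull_expl by blast
      then show ?thesis by simp
    qed
  qed
qed

text \<open>
  All points of a rigid motion have the same velocity.  For the \<open>a\<close>-coordinate of two points whose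
  difference has a strictly larger \<open>a\<close>-coordinate than \<open>b\<close>-coordinate this follows by differentiating
  their constant distance; two arbitrary points are compared with a third one, which lies far away
  from both in the direction where \<open>b\<close> vanishes.
\<close>

lemma rigid_motion_coord:
  assumes \<alpha>: "rigid_motion N \<alpha>"
    and u: "(\<alpha> x has_vector_derivative u) (at 0)" and v: "(\<alpha> y has_vector_derivative v) (at 0)"
  shows "a \<bullet> u = a \<bullet> v"
proof -
  have init: "\<alpha> z 0 = z" for z using \<alpha> by (simp add: rigid_motion_def)
  have key: "a \<bullet> u = a \<bullet> v"
    if less: "\<bar>b \<bullet> (x - y)\<bar> < \<bar>a \<bullet> (x - y)\<bar>"
      and u: "(\<alpha> x has_vector_derivative u) (at 0)" and v: "(\<alpha> y has_vector_derivative v) (at 0)"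
    for x y u v
  proof -
    have "((\<lambda>t. \<alpha> x t - \<alpha> y t) has_vector_derivative u - v) (at 0)"
      using u v by (rule has_vector_derivative_diff)
    then have "((\<lambda>t. N (\<alpha> x t - \<alpha> y t)) has_real_derivative sgn (a \<bullet> (x - y)) * (a \<bullet> (u - v))) (at 0)"
      using N_derivative[of "\<lambda>t. \<alpha> x t - \<alpha> y t" "u - v"] less init by simp
    moreover have "((\<lambda>t. N (\<alpha> x t - \<alpha> y t)) has_real_derivative 0) (at 0)"
    proof (rule has_field_derivative_transform_within)
      show "((\<lambda>t. N (x - y)) has_real_derivative 0) (at 0)" by simp
      show "N (x - y) = N (\<alpha> x t - \<alpha> y t)" if "dist t 0 < 1" for t
      proof -
        have "t \<in> {-1..1}" using that by (auto simp: dist_real_def)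
        then show ?thesis using \<alpha> unfolding rigid_motion_def by metis
      qed
    qed auto
    ultimately have "sgn (a \<bullet> (x - y)) * (a \<bullet> (u - v)) = 0" by (rule DERIV_unique)
    then show ?thesis using less by (auto simp: inner_diff_right sgn_if split: if_splits)
  qed
  obtain f where f: "a \<bullet> f = 1" "b \<bullet> f = 0" using coords_surj by blast
  define k where "k = 1 + \<bar>a \<bullet> x\<bar> + \<bar>a \<bullet> y\<bar> + \<bar>b \<bullet> x\<bar> + \<bar>b \<bullet> y\<bar>"
  define z where "z = k *\<^sub>R f"
  have z: "a \<bullet> z = k" "b \<bullet> z = 0" by (simp_all add: z_def f)
  have "\<alpha> z differentiable (at 0)" using \<alpha> by (simp add: rigid_motion_def)
  then obtain w where w: "(\<alpha> z has_vector_derivative w) (at 0)"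
    using vector_derivative_works by blast
  have "a \<bullet> u = a \<bullet> w" by (rule key[OF _ u w]) (simp add: inner_diff_right z, simp add: k_def)
  moreover have "a \<bullet> v = a \<bullet> w" by (rule key[OF _ v w]) (simp add: inner_diff_right z, simp add: k_def)
  ultimately show ?thesis by simp
qed

text \<open>
  The velocities of a rigid motion agree in both coordinates, and translations realise all constant
  velocities.
\<close>

lemma trivial_flex_iff:
  fixes p u :: "(real ^ 2) ^ 'v::finite"
  shows "trivial_flex N p u \<longleftrightarrow> (\<forall>v w. u $ v = u $ w)"
proof
  assume "trivial_flex N p u"
  then obtain \<alpha> where \<alpha>: "rigid_motion N \<alpha>"
    and d: "\<And>v. (\<alpha> (p $ v) has_vector_derivative u $ v) (at 0)"
    unfolding trivial_flex_def by blast
  have "a \<bullet> (u $ v - u $ w) = 0" "b \<bullet> (u $ v - u $ w) = 0" for v w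
    using rigid_motion_coord[OF \<alpha> d[of v] d[of w]]
      quadrilateral.rigid_motion_coord[OF swap \<alpha> d[of v] d[of w]]
    by (simp_all add: inner_diff_right)
  then show "\<forall>v w. u $ v = u $ w" using coords_zero by (metis eq_iff_diff_eq_0)
next
  assume c: "\<forall>v w. u $ v = u $ w"
  obtain v0 :: 'v where True by simp
  have d: "((\<lambda>t. x + t *\<^sub>R u $ v0) has_vector_derivative u $ v0) (at 0)" for x
    by (auto intro!: derivative_eq_intros)
  have "rigid_motion N (\<lambda>x t. x + t *\<^sub>R u $ v0)"
    unfolding rigid_motion_def
    by (auto intro!: continuous_intros differentiableI_vector[OF d])
  moreover have "((\<lambda>t. p $ v + t *\<^sub>R u $ v0) has_vector_derivative u $ v) (at 0)" for v
    using d[of "p $ v"] c by metis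
  ultimately show "trivial_flex N p u"
    unfolding trivial_flex_def by (intro exI[of _ "\<lambda>x t. x + t *\<^sub>R u $ v0"]) simp
qed


lemma infinitesimal_flex_iff_limits:
  assumes "simple_graph E"
  shows "infinitesimal_flex N E p u \<longleftrightarrow> (\<forall>v w. {v, w} \<in> E \<longrightarrow>
    ((\<lambda>t. (N (p $ v - p $ w + t *\<^sub>R (u $ v - u $ w)) - N (p $ v - p $ w)) / t) \<longlongrightarrow> 0) (at 0))"
proof -
  let ?f = "\<lambda>t. (1 / t) *\<^sub>R (rigidity_map N E (p + t *\<^sub>R u) - rigidity_map N E p)"
  have edge: "?f t $ {v, w} = (N (p $ v - p $ w + t *\<^sub>R (u $ v - u $ w)) - N (p $ v - p $ w)) / t"
    if "{v, w} \<in> E" for v w t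
  proof -
    have "v \<noteq> w" using that assms by (auto simp: simple_graph_def)
    then have "?f t $ {v, w} =
        (N (p $ v + t *\<^sub>R u $ v - (p $ w + t *\<^sub>R u $ w)) - N (p $ v - p $ w)) / t"
      using that by (simp add: rigidity_map_def edge_length_eq[OF norm])
    moreover have "p $ v + t *\<^sub>R u $ v - (p $ w + t *\<^sub>R u $ w) = p $ v - p $ w + t *\<^sub>R (u $ v - u $ w)"
      by (simp add: algebra_simps)
    ultimately show ?thesis by (simp only:)
  qed
  have non_edge: "?f t $ e = 0" if "e \<notin> E" for e t
    using that by (simp add: rigidity_map_def)
  show ?thesis
  proof
    assume "infinitesimal_flex N E p u"
    then have "((\<lambda>t. ?f t $ e) \<longlongrightarrow> 0 $ e) (at 0)" for e
      unfolding infinitesimal_flex_def by (rule tendsto_vec_nth)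
    then have lim: "((\<lambda>t. ?f t $ e) \<longlongrightarrow> 0) (at 0)" for e
      unfolding zero_index .
    show "\<forall>v w. {v, w} \<in> E \<longrightarrow>
      ((\<lambda>t. (N (p $ v - p $ w + t *\<^sub>R (u $ v - u $ w)) - N (p $ v - p $ w)) / t) \<longlongrightarrow> 0) (at 0)"
    proof (intro allI impI)
      fix v w assume "{v, w} \<in> E"
      from lim[of "{v, w}"]
      show "((\<lambda>t. (N (p $ v - p $ w + t *\<^sub>R (u $ v - u $ w)) - N (p $ v - p $ w)) / t) \<longlongrightarrow> 0) (at 0)"
        unfolding edge[OF \<open>{v, w} \<in> E\<close>] .
    qed
  next
    assume lim: "\<forall>v w. {v, w} \<in> E \<longrightarrow>
      ((\<lambda>t. (N (p $ v - p $ w + t *\<^sub>R (u $ v - u $ w)) - N (p $ v - p $ w)) / t) \<longlongrightarrow> 0) (at 0)"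
    have "((\<lambda>t. ?f t $ e) \<longlongrightarrow> 0 $ e) (at 0)" for e
    proof (cases "e \<in> E")
      case True
      then obtain v w where "e = {v, w}"
        using assms by (auto simp: simple_graph_def card_2_iff)
      then have e: "{v, w} \<in> E" using True by simp
      with lim have "((\<lambda>t. (N (p $ v - p $ w + t *\<^sub>R (u $ v - u $ w)) - N (p $ v - p $ w)) / t) \<longlongrightarrow> 0) (at 0)"
        by blast
      then show ?thesis unfolding \<open>e = {v, w}\<close> zero_index edge[OF e] .
    next
      case False
      show ?thesis unfolding non_edge[OF False] zero_index by (rule tendsto_const)
    qed
    then show "infinitesimal_flex N E p u"
      unfolding infinitesimal_flex_def by (rule vec_tendstoI)
  qed
qed

lemma length_rate_zero_iff:
  assumes "\<bar>b \<bullet> d\<bar> < \<bar>a \<bullet> d\<bar>"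
  shows "((\<lambda>t. (N (d + t *\<^sub>R h) - N d) / t) \<longlongrightarrow> 0) (at 0) \<longleftrightarrow> a \<bullet> h = 0"
proof -
  have "((\<lambda>t. d + t *\<^sub>R h) has_vector_derivative h) (at 0)"
    by (auto intro!: derivative_eq_intros)
  from N_derivative[OF this] assms
  have "((\<lambda>t. (N (d + t *\<^sub>R h) - N d) / t) \<longlongrightarrow> sgn (a \<bullet> d) * (a \<bullet> h)) (at 0)"
    by (simp add: DERIV_def)
  moreover have "sgn (a \<bullet> d) \<noteq> 0" using assms by (auto simp: sgn_zero_iff)
  ultimately show ?thesis
    using LIM_unique[of _ "sgn (a \<bullet> d) * (a \<bullet> h)" 0 0] by auto
qed

lemma well_positioned_no_tie:
  assumes "simple_graph E" and "framework E p" and wp: "well_positioned N E p"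
    and e: "{v, w} \<in> E"
  shows "\<bar>a \<bullet> (p $ v - p $ w)\<bar> \<noteq> \<bar>b \<bullet> (p $ v - p $ w)\<bar>"
proof (rule not_differentiable_tie)
  show "p $ v - p $ w \<noteq> 0" using assms(2) e by (auto simp: framework_def)
  fix u
  have vw: "v \<noteq> w" using assms(1) e by (auto simp: simple_graph_def)
  let ?x = "\<lambda>t::real. p + t *\<^sub>R axis v u"
  have "?x differentiable (at 0)" by (intro derivative_intros)
  moreover have "rigidity_map N E differentiable (at (?x 0))"
    using wp by (simp add: well_positioned_def)
  moreover have "(\<lambda>y. y $ {v, w}) differentiable (at (rigidity_map N E (?x 0)))"
    by (intro bounded_linear_imp_differentiable bounded_linear_vec_nth)
  ultimately have "((\<lambda>y. y $ {v, w}) \<circ> (rigidity_map N E \<circ> ?x)) differentiable (at 0)"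
    by (intro differentiable_chain_at) simp_all
  moreover have "((\<lambda>y. y $ {v, w}) \<circ> (rigidity_map N E \<circ> ?x)) t = N (p $ v - p $ w + t *\<^sub>R u)" for t
    using e vw by (simp add: rigidity_map_def edge_length_eq[OF norm vw] axis_def algebra_simps)
  ultimately show "(\<lambda>t. N (p $ v - p $ w + t *\<^sub>R u)) differentiable (at 0)"
    by (simp add: fun_eq_iff[symmetric] o_def)
qed

end

text \<open>
  The vector \<open>p v - p w\<close> lies in the interior of the cone of one of the two facets \<open>\<plusminus>F\<close> with
  functional \<open>\<plusminus>a\<close>, so that the length of the edge is locally a function of the \<open>a\<close>-coordinate of
  \<open>p v - p w\<close> alone.
\<close>

definition governed ::
    "'v::finite set set \<Rightarrow> (real ^ 2) ^ 'v \<Rightarrow> real ^ 2 \<Rightarrow> real ^ 2 \<Rightarrow> 'v \<Rightarrow> 'v \<Rightarrow> bool" where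
  "governed E p a b v w \<longleftrightarrow>
     {v, w} \<in> E \<and> \<bar>b \<bullet> (p $ v - p $ w)\<bar> < \<bar>a \<bullet> (p $ v - p $ w)\<bar>"

lemma governed_sym: "governed E p a b v w \<Longrightarrow> governed E p a b w v"
  by (simp add: governed_def insert_commute inner_diff_right abs_minus_commute)

context quadrilateral
begin

text \<open>
  The infinitesimal flexes decouple into one condition on each coordinate.
\<close>

lemma infinitesimal_flex_iff:
  assumes "simple_graph E" and "framework E p" and "well_positioned N E p"
  shows "infinitesimal_flex N E p u \<longleftrightarrow>
    (\<forall>v w. governed E p a b v w \<longrightarrow> a \<bullet> (u $ v - u $ w) = 0) \<and>
    (\<forall>v w. governed E p b a v w \<longrightarrow> b \<bullet> (u $ v - u $ w) = 0)"
proof -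
  have "((\<lambda>t. (N (p $ v - p $ w + t *\<^sub>R (u $ v - u $ w)) - N (p $ v - p $ w)) / t) \<longlongrightarrow> 0) (at 0) \<longleftrightarrow>
      (governed E p a b v w \<longrightarrow> a \<bullet> (u $ v - u $ w) = 0) \<and>
      (governed E p b a v w \<longrightarrow> b \<bullet> (u $ v - u $ w) = 0)"
    if e: "{v, w} \<in> E" for v w
  proof -
    consider "governed E p a b v w" "\<not> governed E p b a v w"
      | "governed E p b a v w" "\<not> governed E p a b v w"
      using well_positioned_no_tie[OF assms e] e by (force simp: governed_def)
    then show ?thesis
    proof cases
      case 1
      then show ?thesis
        using length_rate_zero_iff[of "p $ v - p $ w"] by (simp add: governed_def)
    next
      case 2
      then show ?thesis
        using quadrilateral.length_rate_zero_iff[OF swap, of "p $ v - p $ w"]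
        by (simp add: governed_def)
    qed
  qed
  then show ?thesis
    unfolding infinitesimal_flex_iff_limits[OF assms(1)] by (auto simp: governed_def)
qed

text \<open>
  If the edges governed by \<open>a\<close> do not connect the vertices, one of their components can be moved in
  the direction in which \<open>b\<close> vanishes: no edge governed by \<open>a\<close> leaves the component, and the
  other edges do not notice the motion.
\<close>

lemma rigid_imp_governed_connected:
  assumes "simple_graph E" and "framework E p" and "well_positioned N E p"
    and rigid: "infinitesimally_rigid N E p"
  shows "(governed E p a b)\<^sup>*\<^sup>* x y"
proof (rule ccontr)
  let ?r = "(governed E p a b)\<^sup>*\<^sup>* x"
  assume xy: "\<not> ?r y"
  obtain f where f: "a \<bullet> f = 1" "b \<bullet> f = 0" using coords_surj by blast
  define u where "u = (\<chi> v. if ?r v then f else 0)"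
  have "u $ v = u $ w" if "governed E p a b v w" for v w
  proof -
    have "?r v \<longleftrightarrow> ?r w"
      using that governed_sym[OF that] by (meson rtranclp.rtrancl_into_rtrancl)
    then show ?thesis by (simp add: u_def)
  qed
  moreover have "b \<bullet> (u $ v) = 0" for v by (simp add: u_def f)
  ultimately have "infinitesimal_flex N E p u"
    unfolding infinitesimal_flex_iff[OF assms(1-3)] by (simp add: inner_diff_right)
  then have "u $ x = u $ y"
    using rigid trivial_flex_iff[of p u] unfolding infinitesimally_rigid_def by blast
  then show False using xy f by (auto simp: u_def)
qed

lemma flex_coord_constant:
  assumes "\<And>v w. governed E p a b v w \<Longrightarrow> a \<bullet> (u $ v - u $ w) = 0"
    and "(governed E p a b)\<^sup>*\<^sup>* x y"
  shows "a \<bullet> u $ x = a \<bullet> u $ y"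
  using assms(2)
proof (induction rule: rtranclp_induct)
  case (step y z)
  then show ?case using assms(1)[OF step(2)] by (simp add: inner_diff_right)
qed simp

lemma rigid_iff_governed_connected:
  assumes "simple_graph E" and "framework E p" and "well_positioned N E p"
  shows "infinitesimally_rigid N E p \<longleftrightarrow>
    (\<forall>x y. (governed E p a b)\<^sup>*\<^sup>* x y) \<and> (\<forall>x y. (governed E p b a)\<^sup>*\<^sup>* x y)"
proof
  assume "infinitesimally_rigid N E p"
  then show "(\<forall>x y. (governed E p a b)\<^sup>*\<^sup>* x y) \<and> (\<forall>x y. (governed E p b a)\<^sup>*\<^sup>* x y)"
    using rigid_imp_governed_connected[OF assms]
      quadrilateral.rigid_imp_governed_connected[OF swap assms] by blast
next
  assume con: "(\<forall>x y. (governed E p a b)\<^sup>*\<^sup>* x y) \<and> (\<forall>x y. (governed E p b a)\<^sup>*\<^sup>* x y)"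
  show "infinitesimally_rigid N E p"
    unfolding infinitesimally_rigid_def
  proof (intro allI impI)
    fix u assume "infinitesimal_flex N E p u"
    then have flex: "\<And>v w. governed E p a b v w \<Longrightarrow> a \<bullet> (u $ v - u $ w) = 0"
      and flex': "\<And>v w. governed E p b a v w \<Longrightarrow> b \<bullet> (u $ v - u $ w) = 0"
      using infinitesimal_flex_iff[OF assms] by blast+
    have "u $ v = u $ w" for v w
    proof -
      have "a \<bullet> u $ v = a \<bullet> u $ w" "b \<bullet> u $ v = b \<bullet> u $ w"
        using flex_coord_constant[of E p u, OF flex]
          quadrilateral.flex_coord_constant[OF swap, of E p u, OF flex'] con by blast+
      then show ?thesis using coords_zero[of "u $ v - u $ w"] by (simp add: inner_diff_right)
    qed
    then show "trivial_flex N p u" using trivial_flex_iff by blast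
  qed
qed

lemma colour_iff:
  assumes "F = {x. N x \<le> 1 \<and> a \<bullet> x = 1}"
  shows "edge_has_colour p F {v, w} \<longleftrightarrow> \<bar>b \<bullet> (p $ v - p $ w)\<bar> \<le> \<bar>a \<bullet> (p $ v - p $ w)\<bar>"
  unfolding edge_has_colour_def cone_facet[OF assms]
  by (auto simp: doubleton_eq_iff inner_diff_right abs_minus_commute)

end

text \<open>
  The two norms have the same unit ball and are homogeneous, hence they agree.
\<close>

lemma quadrilateral_norm_imp_quadrilateral:
  assumes "quadrilateral_norm N F\<^sub>1 F\<^sub>2 a b"
  shows "quadrilateral N a b"
proof
  show norm: "is_norm N" using assms by (simp add: quadrilateral_norm_def)
  have ball: "N x \<le> 1 \<longleftrightarrow> max \<bar>a \<bullet> x\<bar> \<bar>b \<bullet> x\<bar> \<le> 1" for x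
    using assms by (auto simp: quadrilateral_norm_def Let_def set_eq_iff)
  have scale: "N (c *\<^sub>R x) = \<bar>c\<bar> * N x" for c x using norm by (simp add: is_norm_def)
  fix x
  let ?m = "max \<bar>a \<bullet> x\<bar> \<bar>b \<bullet> x\<bar>"
  have iff: "N x \<le> r \<longleftrightarrow> ?m \<le> r" if "r > 0" for r
    using ball[of "x /\<^sub>R r"] that by (simp add: scale abs_mult field_simps)
  have "N x \<ge> 0" "?m \<ge> 0" using norm by (auto simp: is_norm_def)
  show "N x = ?m"
  proof (rule antisym)
    show "N x \<le> ?m"
    proof (rule dense_ge)
      fix r assume "?m < r"
      then have "r > 0" "?m \<le> r" using \<open>?m \<ge> 0\<close> by linarith+
      then show "N x \<le> r" using iff by blast
    qed
    show "?m \<le> N x"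
    proof (rule dense_ge)
      fix r assume "N x < r"
      then have "r > 0" "N x \<le> r" using \<open>N x \<ge> 0\<close> by linarith+
      then show "?m \<le> r" using iff by blast
    qed
  qed
qed

text \<open>
  The coordinates \<open>a\<close> and \<open>b\<close> diagonalise the reflection, with eigenvalues \<open>-1\<close> and \<open>1\<close>; this is why
  the symmetry preserves the colour of an edge.
\<close>

lemma reflection_coords:
  assumes "is_reflection T {x. a \<bullet> x = 0} {x. b \<bullet> x = 0}"
  shows "a \<bullet> T x = - (a \<bullet> x)" "b \<bullet> T x = b \<bullet> x"
proof -
  obtain P where P: "linear P" "P \<circ> P = P" "range P = {x. b \<bullet> x = 0}" "{x. P x = 0} = {x. a \<bullet> x = 0}"
    "T = (\<lambda>x. x - 2 *\<^sub>R P x)"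
    using assms unfolding is_reflection_def by blast
  have "P (x - P x) = 0" using P(1,2) by (simp add: linear_diff fun_eq_iff)
  then have "a \<bullet> (x - P x) = 0" using P(4) by blast
  moreover have "b \<bullet> P x = 0" using P(3) by blast
  ultimately show "a \<bullet> T x = - (a \<bullet> x)" "b \<bullet> T x = b \<bullet> x"
    by (simp_all add: P(5) inner_diff_right)
qed


section \<open>Rigidity in terms of the quotient graph\<close>

context free_symmetric_graph
begin

text \<open>
  The graph of the edges governed by \<open>a\<close> is the double cover of a monochrome quotient graph.
\<close>

lemma monochrome_connected_iff:
  fixes p :: "(real ^ 2) ^ 'v" and F :: "(real ^ 2) set"
  assumes colour: "\<And>v w. {v, w} \<in> E \<Longrightarrow> edge_has_colour p F {v, w} \<longleftrightarrow> governed E p a b v w"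
    and opp_colour: "\<And>v w. governed E p a b v w \<Longrightarrow> governed E p a b (opp v) (opp w)"
  shows "(\<forall>x y. (governed E p a b)\<^sup>*\<^sup>* x y) \<longleftrightarrow>
    (\<exists>H. subgraph_of H (monochrome_quotient E \<theta> p F) \<and>
       connected_graph H \<and> spanning_in Q H \<and> unbalanced_map_graph Q (gain R) H)"
proof -
  define M where "M = {b \<in> edges Q. \<forall>e\<in>b. edge_has_colour p F e}"
  have M: "M \<subseteq> edges Q" by (auto simp: M_def)
  have mono: "monochrome_quotient E \<theta> p F = \<lparr>verts = \<Union> (ends Q ` M), edges = M, ends = ends Q\<rparr>"
    by (simp add: monochrome_quotient_def M_def Let_def)
  have "{x, y} \<in> \<Union>M \<longleftrightarrow> governed E p a b x y" for x y
  proof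
    assume "{x, y} \<in> \<Union>M"
    then obtain c where c: "c \<in> edges Q" "{x, y} \<in> c" "edge_has_colour p F {x, y}"
      by (auto simp: M_def)
    obtain e where e: "e \<in> E" "c = edge_orbit \<theta> e" using c(1) by (auto simp: quotient_graph_def)
    obtain v w where "e = {v, w}" using edge_obtain[OF e(1)] .
    then have "{x, y} \<in> E" using c(2) e opp_edge[of v w] by (auto simp: edge_orbit_pair)
    then show "governed E p a b x y" using colour c(3) by blast
  next
    assume g: "governed E p a b x y"
    then have E: "{x, y} \<in> E" by (simp add: governed_def)
    have g': "governed E p a b (opp x) (opp y)" using opp_colour[OF g] .
    then have "{opp x, opp y} \<in> E" by (simp add: governed_def)
    then have "\<forall>e\<in>edge_orbit \<theta> {x, y}. edge_has_colour p F e"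
      using E g g' colour by (simp add: edge_orbit_pair)
    moreover have "edge_orbit \<theta> {x, y} \<in> edges Q" using E by (simp add: quotient_graph_def)
    moreover have "{x, y} \<in> edge_orbit \<theta> {x, y}" by (simp add: edge_orbit_pair)
    ultimately show "{x, y} \<in> \<Union>M" unfolding M_def by blast
  qed
  then have "joined M = (governed E p a b)\<^sup>*\<^sup>*" by (simp add: joined_def)
  then show ?thesis using all_joined_iff_map_graph[OF M] unfolding mono by simp
qed

end

theorem corollary17:
  fixes N :: "real ^ 2 \<Rightarrow> real"
    and F\<^sub>1 F\<^sub>2 :: "(real ^ 2) set"
    and a\<^sub>1 a\<^sub>2 :: "real ^ 2"
    and E :: "'v::finite set set"
    and \<theta> :: "int \<Rightarrow> 'v \<Rightarrow> 'v"
    and \<tau> :: "int \<Rightarrow> real ^ 2 \<Rightarrow> real ^ 2"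
    and p :: "(real ^ 2) ^ 'v"
    and R :: "'v set"
  assumes "quadrilateral_norm N F\<^sub>1 F\<^sub>2 a\<^sub>1 a\<^sub>2"
    and "symmetric_graph E \<theta>"
    and "framework E p" and "well_positioned N E p"
    and "\<tau> \<in> hom sign_img (isom_group N)"
    and "symmetric_framework \<theta> \<tau> p"
    and "free_action \<theta>"
    and "is_reflection (\<tau> (-1)) {x. a\<^sub>1 \<bullet> x = 0} {x. a\<^sub>2 \<bullet> x = 0}"
    and "vertex_representatives \<theta> R"
  shows "infinitesimally_rigid N E p \<longleftrightarrow>
    (\<forall>F\<in>{F\<^sub>1, F\<^sub>2}. \<exists>H. subgraph_of H (monochrome_quotient E \<theta> p F) \<and>
       connected_graph H \<and> spanning_in (quotient_graph E \<theta>) H \<and>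
       unbalanced_map_graph (quotient_graph E \<theta>) (gain R) H)"
proof -
  interpret free_symmetric_graph E \<theta> R
    using assms by unfold_locales
  have quad: "quadrilateral N a\<^sub>1 a\<^sub>2" using assms(1) by (rule quadrilateral_norm_imp_quadrilateral)
  have quad': "quadrilateral N a\<^sub>2 a\<^sub>1" using quad by (rule quadrilateral.swap)
  have simple: "simple_graph E" using assms(2) by (simp add: symmetric_graph_def)
  have F: "F\<^sub>1 = {x. N x \<le> 1 \<and> a\<^sub>1 \<bullet> x = 1}" "F\<^sub>2 = {x. N x \<le> 1 \<and> a\<^sub>2 \<bullet> x = 1}"
    using assms(1) by (auto simp: quadrilateral_norm_def Let_def)
  note no_tie = quadrilateral.well_positioned_no_tie[OF quad simple assms(3,4)]
  have colour: "edge_has_colour p F\<^sub>1 {v, w} \<longleftrightarrow> governed E p a\<^sub>1 a\<^sub>2 v w"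
    "edge_has_colour p F\<^sub>2 {v, w} \<longleftrightarrow> governed E p a\<^sub>2 a\<^sub>1 v w" if "{v, w} \<in> E" for v w
    using no_tie[OF that] that quadrilateral.colour_iff[OF quad F(1), of p v w]
      quadrilateral.colour_iff[OF quad' F(2), of p v w] by (auto simp: governed_def)
  have p: "p $ opp v = \<tau> (-1) (p $ v)" for v
    using assms(6) by (simp add: symmetric_framework_def)
  have coords: "\<bar>a\<^sub>1 \<bullet> (p $ opp v - p $ opp w)\<bar> = \<bar>a\<^sub>1 \<bullet> (p $ v - p $ w)\<bar>"
    "\<bar>a\<^sub>2 \<bullet> (p $ opp v - p $ opp w)\<bar> = \<bar>a\<^sub>2 \<bullet> (p $ v - p $ w)\<bar>" for v w
    using reflection_coords[OF assms(8)] by (simp_all add: p inner_diff_right abs_minus_commute)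
  have opp_colour: "governed E p a\<^sub>1 a\<^sub>2 (opp v) (opp w)" if "governed E p a\<^sub>1 a\<^sub>2 v w" for v w
    using that opp_edge[of v w] by (simp add: governed_def coords)
  have opp_colour': "governed E p a\<^sub>2 a\<^sub>1 (opp v) (opp w)" if "governed E p a\<^sub>2 a\<^sub>1 v w" for v w
    using that opp_edge[of v w] by (simp add: governed_def coords)
  show ?thesis
    using quadrilateral.rigid_iff_governed_connected[OF quad simple assms(3,4)]
      monochrome_connected_iff[OF colour(1) opp_colour]
      monochrome_connected_iff[OF colour(2) opp_colour']
    by simp
qed

end
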